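(* Let $N\ge1$ and let $\sigma^{(2)}=p_1p_2$, where $p_1,p_2$ are independent, each uniformly random among the $(N-1)!$ cycles of length $N$ in $S_N$. Let $\boldsymbol\nu=(\nu_1,\nu_2,\dots)$ be any sequence of nonnegative integers with $\sum_{\ell\ge1}\ell\nu_\ell=N$, and let $P_N(\boldsymbol\nu)$ be the probability that $\sigma^{(2)}$ has exactly $\nu_\ell$ cycles of length $\ell$ for every $\ell\ge 1$. Then \[ P_N(\boldsymbol\nu)=\frac{N}{\prod_{\ell}\ell^{\nu_\ell}\nu_\ell!}\int_0^1\prod_{\ell\ge1}\bigl[t^\ell+(-1)^{\ell+1}(1-t)^\ell\bigr]^{\nu_\ell}\,dt. \] *)

theory Defs
  imports "HOL-Combinatorics.Orbits" "HOL-Probability.Probability"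
begin

text \<open>The symmetric group on \<open>N\<close> letters acts on \<open>{1..N}\<close>.\<close>

definition full_cycles :: "nat \<Rightarrow> (nat \<Rightarrow> nat) set" where
  "full_cycles N = {p. p permutes {1..N} \<and> cyclic_on p {1..N}}"

text \<open>The cycles of a permutation are identified with its orbits, so that fixed points in
  \<open>{1..N}\<close> count as cycles of length 1.\<close>

definition num_cycles :: "nat \<Rightarrow> (nat \<Rightarrow> nat) \<Rightarrow> nat \<Rightarrow> nat" where
  "num_cycles N p l = card {C \<in> orbit p ` {1..N}. card C = l}"

definition random_full_cycle_pair :: "nat \<Rightarrow> ((nat \<Rightarrow> nat) \<times> (nat \<Rightarrow> nat)) pmf" where
  "random_full_cycle_pair N =
     pair_pmf (pmf_of_set (full_cycles N)) (pmf_of_set (full_cycles N))"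

definition cycle_type_prob :: "nat \<Rightarrow> (nat \<Rightarrow> nat) \<Rightarrow> real" where
  "cycle_type_prob N \<nu> =
     measure_pmf.prob (random_full_cycle_pair N)
       {(p1, p2). \<forall>l\<ge>1. num_cycles N (p1 \<circ> p2) l = \<nu> l}"

text \<open>The index set of the sums and products over \<open>l \<ge> 1\<close>: all omitted terms are 0,
  respectively all omitted factors are 1. The value \<open>\<nu> 0\<close> is never used.\<close>

definition parts :: "(nat \<Rightarrow> nat) \<Rightarrow> nat set" where
  "parts \<nu> = {l. l \<ge> 1 \<and> \<nu> l \<noteq> 0}"

end

theory Submission
  imports Defs
begin

text \<open>Multiplication on the left by a transposition \<open>(x y)\<close> merges the cycles of \<open>x\<close> and \<open>y\<close> if they
  differ and splits their common cycle otherwise. Every full cycle on \<open>insert a S\<close> is uniquely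
  \<open>(a b) q\<close> with \<open>b \<in> S\<close> and \<open>q\<close> a full cycle on \<open>S\<close>. Hence products of two full cycles on
  \<open>insert a S\<close> are the elements \<open>(a i)(a j) q1 q2\<close>, where \<open>(a i)(a j) = (a j)(j i)\<close> for \<open>i \<noteq> j\<close>. By
  induction on \<open>S\<close>, a permutation \<open>p\<close> is therefore a product of two full cycles in \<open>(N - 1)! W(p)\<close>
  ways, where \<open>W(p) = \<integral> \<Prod>\<^sub>C f\<^bsub>|C|\<^esub>(t) dt\<close> over the cycles \<open>C\<close> of \<open>p\<close> and \<open>f\<^sub>l(t) = t^l - (t - 1)^l\<close>. The
  induction step amounts to a recurrence for \<open>W\<close>: its two sides differ by the integral of the
  derivative of a function vanishing at 0 and 1. Multiplying by the number
  \<open>N! / \<Prod>\<^sub>l l^\<nu>\<^sub>l \<nu>\<^sub>l!\<close> of permutations of the given cycle type, which comes from the same insertion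
  of \<open>a\<close> into a cycle, and dividing by the \<open>(N - 1)!\<^sup>2\<close> pairs gives the claim.\<close>

hide_const (open) Finite_Cartesian_Product.transpose

subsection \<open>Cycles and transpositions\<close>

text \<open>One list equation says that each entry is sent to the next and the last one back to
  \<open>x\<close>. The starting point stays outside \<open>xs\<close>, so that joining and cutting
  cycles become operations on appended lists.\<close>

definition traverses :: "('a \<Rightarrow> 'a) \<Rightarrow> 'a \<Rightarrow> 'a list \<Rightarrow> bool" where
  "traverses p x xs \<longleftrightarrow> distinct (x # xs) \<and> map p (x # xs) = xs @ [x]"

text \<open>The end point \<open>y\<close> is kept apart from \<open>x\<close>: in the induction the
  start moves on to \<open>p x\<close> while the end stays.\<close>

lemma chain_subset_orbit:
  "map p (x # xs) = xs @ [y] \<Longrightarrow> set (xs @ [y]) \<subseteq> orbit p x"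
proof (induction xs arbitrary: x)
  case Nil
  then show ?case by (auto intro: orbit.base)
next
  case (Cons u us)
  then have "set (us @ [y]) \<subseteq> orbit p (p x)" by simp
  then show ?case using Cons.prems by (auto intro: orbit.base orbit_subset)
qed

lemma traverses_cyclic_on:
  assumes "traverses p x xs"
  shows "cyclic_on p (set (x # xs))"
proof (rule cyclic_on_singleI)
  have m: "map p (x # xs) = xs @ [x]" using assms by (simp add: traverses_def)
  have "p ` set (x # xs) = set (x # xs)"
    using arg_cong[OF m, of set] by simp
  then have closed: "p y \<in> set (x # xs)" if "y \<in> set (x # xs)" for y
    using that by blast
  have "y \<in> set (x # xs)" if "y \<in> orbit p x" for y
    using that by induction (rule closed; simp)+
  then show "set (x # xs) = orbit p x"
    using chain_subset_orbit[OF m] by auto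
qed simp

lemma traverses_exists:
  assumes "x \<in> orbit p x"
  obtains xs where "traverses p x xs" "set (x # xs) = orbit p x"
proof -
  \<comment> \<open>The first return time of \<open>x\<close>: the cycle consists of the iterates
    before it, and iterate \<open>n\<close> closes it.\<close>
  define n where "n = funpow_dist1 p x x"
  define g where "g = (\<lambda>k. (p ^^ k) x)"
  define xs where "xs = map g [1..<n]"
  have n: "n > 0" by (simp add: n_def)
  have gn: "g n = x" using funpow_dist1_prop[OF assms] by (simp add: n_def g_def)
  have xxs: "x # xs = map g [0..<n]"
    using n by (simp add: xs_def upt_rec[of 0] g_def)
  have "map p (map g [0..<n]) = map g (map Suc [0..<n])"
    by (simp add: g_def del: map_Suc_upt)
  also have "\<dots> = xs @ [x]" using n by (simp add: xs_def gn map_Suc_upt)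
  finally have "map p (x # xs) = xs @ [x]" unfolding xxs .
  moreover have "distinct (x # xs)"
    unfolding xxs using inj_on_funpow_dist1[OF assms]
    by (simp add: distinct_map n_def g_def del: upt_Suc)
  moreover have "set (x # xs) = orbit p x"
    unfolding xxs using orbit_conv_funpow_dist1[OF assms] by (simp add: n_def g_def del: upt_Suc)
  ultimately show thesis using that by (auto simp: traverses_def)
qed

text \<open>A transposition applied after \<open>p\<close> redirects only the arrows into
  \<open>x\<close> and \<open>y\<close>. These leave the last entries of the two chains, so each
  chain now runs on into the other.\<close>

lemma traverses_merge:
  assumes "traverses p x xs" "traverses p y ys" "set (x # xs) \<inter> set (y # ys) = {}"
  shows "traverses (transpose x y \<circ> p) x (xs @ y # ys)"
proof -
  have m: "p x # map p xs = xs @ [x]" "p y # map p ys = ys @ [y]"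
    and d: "distinct (x # xs)" "distinct (y # ys)"
    using assms by (auto simp: traverses_def)
  have "map (transpose x y) xs = xs" "map (transpose x y) ys = ys"
    using d assms(3) by (auto intro!: map_idI simp: Transposition.transpose_def)
  then have "map (transpose x y) (p x # map p xs) = xs @ [y]"
    "map (transpose x y) (p y # map p ys) = ys @ [x]"
    unfolding m by auto
  then show ?thesis using d assms(3) by (auto simp: traverses_def)
qed

text \<open>The same two arrows are redirected: the one that entered \<open>y\<close> now closes the
  first half at \<open>x\<close>, and the one that entered \<open>x\<close> closes the second half
  at \<open>y\<close>.\<close>

lemma traverses_split:
  assumes "traverses p x (xs @ y # ys)"
  shows "traverses (transpose x y \<circ> p) x xs" "traverses (transpose x y \<circ> p) y ys"
proof -
  have m: "(p x # map p xs) @ (p y # map p ys) = (xs @ [y]) @ (ys @ [x])"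
    and d: "distinct (x # xs @ y # ys)"
    using assms by (auto simp: traverses_def)
  \<comment> \<open>The parts before the cut have equal length on both sides, so the equation splits
    into one for each half.\<close>
  then have m: "p x # map p xs = xs @ [y]" "p y # map p ys = ys @ [x]"
    using append_eq_append_conv[of "p x # map p xs" "xs @ [y]"] by auto
  have "map (transpose x y) xs = xs" "map (transpose x y) ys = ys"
    using d by (auto intro!: map_idI simp: Transposition.transpose_def)
  then have "map (transpose x y) (p x # map p xs) = xs @ [x]"
    "map (transpose x y) (p y # map p ys) = ys @ [y]"
    unfolding m by auto
  then show "traverses (transpose x y \<circ> p) x xs" "traverses (transpose x y \<circ> p) y ys"
    using d by (auto simp: traverses_def)
qed

section \<open>The orbits of a permutation of a finite set as a partition\<close>

context
  fixes S :: "'a set" and p :: "'a \<Rightarrow> 'a"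
  assumes S: "finite S" and p: "p permutes S"
begin

lemma permutes_self_in_orbit: "x \<in> orbit p x"
  using S p by (intro permutation_self_in_orbit) (auto simp: permutation_permutes)

lemma permutes_orbit_eq: "z \<in> orbit p x \<Longrightarrow> orbit p z = orbit p x"
  by (rule orbit_cyclic_eq3[OF cyclic_on_orbit[OF p S]])

lemma permutes_orbit_disjoint:
  assumes "orbit p x \<noteq> orbit p y"
  shows "orbit p x \<inter> orbit p y = {}"
proof (rule equals0I)
  fix z assume "z \<in> orbit p x \<inter> orbit p y"
  then show False using permutes_orbit_eq[of z x] permutes_orbit_eq[of z y] assms by simp
qed

lemma Union_orbits: "\<Union>(orbit p ` S) = S"
proof (intro equalityI subsetI)
  fix x assume "x \<in> \<Union>(orbit p ` S)"
  then obtain z where "z \<in> S" "x \<in> orbit p z" by auto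
  then show "x \<in> S" using permutes_orbit_subset[OF p, of z] by auto
next
  fix x assume "x \<in> S"
  then show "x \<in> \<Union>(orbit p ` S)" using permutes_self_in_orbit[of x] by auto
qed

lemma finite_permutes_orbit: "finite (orbit p x)"
  by (rule finite_orbit[OF permutes_self_in_orbit])

lemma card_orbit_pos: "card (orbit p x) > 0"
  using finite_permutes_orbit[of x] orbit_nonempty[of p x] by (simp add: card_gt_0_iff)

lemma orbits_disjoint:
  "C \<in> orbit p ` S \<Longrightarrow> D \<in> orbit p ` S \<Longrightarrow> C \<noteq> D \<Longrightarrow> C \<inter> D = {}"
  using permutes_orbit_disjoint by (elim imageE) simp

lemma sum_over_orbits:
  fixes g :: "'a \<Rightarrow> 'b :: comm_monoid_add"
  shows "(\<Sum>x\<in>S. g x) = (\<Sum>C\<in>orbit p ` S. \<Sum>x\<in>C. g x)"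
proof -
  have "sum g (\<Union>(orbit p ` S)) = (sum \<circ> sum) g (orbit p ` S)"
  proof (rule sum.Union_disjoint)
    show "\<forall>C\<in>orbit p ` S. finite C"
      using finite_permutes_orbit by simp
    show "\<forall>C\<in>orbit p ` S. \<forall>D\<in>orbit p ` S. C \<noteq> D \<longrightarrow> C \<inter> D = {}"
      by (intro ballI impI) (rule orbits_disjoint)
  qed
  then show ?thesis by (simp add: Union_orbits)
qed

lemma sum_card_orbits: "(\<Sum>C\<in>orbit p ` S. card C) = card S"
  using sum_over_orbits[of "\<lambda>_. 1 :: nat"] by simp

end

text \<open>A cyclic set is the orbit of each of its points, so a cover by cyclic sets consists of
  exactly the orbits.\<close>

lemma orbit_image_eqI:
  assumes "\<Union>P = S" "\<And>C. C \<in> P \<Longrightarrow> cyclic_on q C"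
  shows "orbit q ` S = P"
proof (intro equalityI subsetI)
  fix C assume "C \<in> orbit q ` S"
  then obtain z where z: "z \<in> S" "C = orbit q z" by auto
  then obtain D where "D \<in> P" "z \<in> D" using assms(1) by auto
  then show "C \<in> P" using assms(2) z(2) orbit_cyclic_eq3[of q D z] by simp
next
  fix C assume C: "C \<in> P"
  then obtain z where "z \<in> C" "C = orbit q z"
    using assms(2) unfolding cyclic_on_def by metis
  then show "C \<in> orbit q ` S" using assms(1) C by auto
qed

text \<open>As \<open>p\<close> maps \<open>C\<close> into itself, it never takes the values
  \<open>x\<close> and \<open>y\<close> there, and the transposition changes nothing on
  \<open>C\<close>.\<close>

lemma cyclic_on_transpose_comp:
  assumes "cyclic_on p C" "x \<notin> C" "y \<notin> C"
  shows "cyclic_on (transpose x y \<circ> p) C"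
proof -
  have "p z = (transpose x y \<circ> p) z" if "z \<in> C" for z
  proof -
    have "p z \<in> C" using that assms(1) by (rule cyclic_on_inI[rotated])
    then show ?thesis using assms by (auto simp: Transposition.transpose_def)
  qed
  then show ?thesis using assms(1) cyclic_cong[of C p] by blast
qed

lemma cyclic_on_other_orbit:
  assumes "finite S" "p permutes S" "C \<in> orbit p ` S" "C \<noteq> orbit p x" "C \<noteq> orbit p y"
  shows "cyclic_on (transpose x y \<circ> p) C"
proof (rule cyclic_on_transpose_comp)
  show cyc: "cyclic_on p C" using assms by (auto intro: cyclic_on_orbit)
  show "x \<notin> C" "y \<notin> C"
    using orbit_cyclic_eq3[OF cyc] assms(4,5) by auto
qed

lemma orbits_merge:
  assumes S: "finite S" and p: "p permutes S" and xy: "x \<in> S" "y \<in> S" "orbit p y \<noteq> orbit p x"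
  shows "orbit (transpose x y \<circ> p) ` S =
    insert (orbit p x \<union> orbit p y) (orbit p ` S - {orbit p x} - {orbit p y})"
proof (rule orbit_image_eqI)
  have "orbit p ` S = insert (orbit p x) (insert (orbit p y) (orbit p ` S - {orbit p x} - {orbit p y}))"
    using xy by auto
  then have "\<Union>(orbit p ` S) = orbit p x \<union> (orbit p y \<union> \<Union>(orbit p ` S - {orbit p x} - {orbit p y}))"
    by (metis Union_insert)
  then show "\<Union>(insert (orbit p x \<union> orbit p y) (orbit p ` S - {orbit p x} - {orbit p y})) = S"
    using Union_orbits[OF S p] by (simp add: Un_assoc)
  obtain xs where xs: "traverses p x xs" "set (x # xs) = orbit p x"
    by (rule traverses_exists[OF permutes_self_in_orbit[OF S p]])
  obtain ys where ys: "traverses p y ys" "set (y # ys) = orbit p y"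
    by (rule traverses_exists[OF permutes_self_in_orbit[OF S p]])
  have "traverses (transpose x y \<circ> p) x (xs @ y # ys)"
    using xs(1) ys(1)
  proof (rule traverses_merge)
    show "set (x # xs) \<inter> set (y # ys) = {}"
      unfolding xs(2) ys(2) by (rule permutes_orbit_disjoint[OF S p]) (use xy in simp)
  qed
  moreover have "set (x # xs @ y # ys) = orbit p x \<union> orbit p y"
    using xs ys by auto
  ultimately have cyc: "cyclic_on (transpose x y \<circ> p) (orbit p x \<union> orbit p y)"
    using traverses_cyclic_on[of "transpose x y \<circ> p" x "xs @ y # ys"] by (simp only:)
  show "cyclic_on (transpose x y \<circ> p) C"
    if "C \<in> insert (orbit p x \<union> orbit p y) (orbit p ` S - {orbit p x} - {orbit p y})" for C
  proof (cases "C = orbit p x \<union> orbit p y")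
    case False
    then show ?thesis using that by (intro cyclic_on_other_orbit[OF S p]) auto
  qed (simp add: cyc)
qed

lemma orbits_split:
  assumes S: "finite S" and p: "p permutes S" and x: "x \<in> S"
    and t: "traverses p x (xs @ y # ys)" "set (x # xs @ y # ys) = orbit p x"
  shows "orbit (transpose x y \<circ> p) ` S =
    insert (set (x # xs)) (insert (set (y # ys)) (orbit p ` S - {orbit p x}))"
proof (rule orbit_image_eqI)
  have "\<Union>(insert (set (x # xs)) (insert (set (y # ys)) (orbit p ` S - {orbit p x})))
      = set (x # xs @ y # ys) \<union> \<Union>(orbit p ` S - {orbit p x})"
    by auto
  also have "\<dots> = \<Union>(insert (orbit p x) (orbit p ` S - {orbit p x}))"
    unfolding t by (simp only: Union_insert)
  also have "insert (orbit p x) (orbit p ` S - {orbit p x}) = orbit p ` S"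
    using x by auto
  finally show "\<Union>(insert (set (x # xs)) (insert (set (y # ys)) (orbit p ` S - {orbit p x}))) = S"
    using Union_orbits[OF S p] by simp
  have "y \<in> orbit p x" using t(2) by auto
  then have y: "orbit p y = orbit p x" using permutes_orbit_eq[OF S p] by simp
  show "cyclic_on (transpose x y \<circ> p) C"
    if C: "C \<in> insert (set (x # xs)) (insert (set (y # ys)) (orbit p ` S - {orbit p x}))" for C
  proof -
    consider "C = set (x # xs)" | "C = set (y # ys)" | "C \<in> orbit p ` S" "C \<noteq> orbit p x"
      using C by blast
    then show ?thesis
    proof cases
      case 1
      then show ?thesis using traverses_cyclic_on[OF traverses_split(1)[OF t(1)]] by simp
    next
      case 2
      then show ?thesis using traverses_cyclic_on[OF traverses_split(2)[OF t(1)]] by simp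
    next
      case 3
      then show ?thesis using y by (intro cyclic_on_other_orbit[OF S p]) auto
    qed
  qed
qed

subsection \<open>The integral weight of a cycle type\<close>

text \<open>The factor \<open>t ^ l + (-1) ^ (l + 1) * (1 - t) ^ l\<close> of the claimed integrand,
  written in powers of \<open>t\<close> and \<open>t - 1\<close>. The identities below rest on these
  two bases differing by 1.\<close>

definition cycle_poly :: "nat \<Rightarrow> real \<Rightarrow> real" where
  "cycle_poly l t = t ^ l - (t - 1) ^ l"

definition cycle_weight :: "nat multiset \<Rightarrow> real" where
  "cycle_weight M = integral {0..1} (\<lambda>t. \<Prod>l\<in>#M. cycle_poly l t)"

lemma cycle_poly_1 [simp]: "cycle_poly (Suc 0) t = 1"
  by (simp add: cycle_poly_def)

lemma has_field_derivative_cycle_poly [derivative_intros]: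
  "(cycle_poly l has_field_derivative real l * cycle_poly (l - 1) t) (at t)"
  unfolding cycle_poly_def by (auto intro!: derivative_eq_intros simp: algebra_simps)

lemma continuous_on_cycle_poly [continuous_intros]: "continuous_on A (cycle_poly l)"
  unfolding cycle_poly_def by (intro continuous_intros)

lemma has_integral_cycle_weight:
  "((\<lambda>t. \<Prod>l\<in>#M. cycle_poly l t) has_integral cycle_weight M) {0..1}"
proof -
  have "continuous_on {0..1} (\<lambda>t. \<Prod>l\<in>#M. cycle_poly l t)"
    by (induction M) (auto intro!: continuous_intros)
  then show ?thesis
    unfolding cycle_weight_def by (intro integrable_integral integrable_continuous_real)
qed

lemma cycle_weight_add_1 [simp]: "cycle_weight (add_mset (Suc 0) M) = cycle_weight M"
  by (simp add: cycle_weight_def)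

text \<open>On expanding with \<open>a = t\<close> and \<open>b = t - 1\<close>, the mixed terms
  cancel and \<open>(a - b) * (a ^ (l + m) - b ^ (l + m))\<close> remains, where
  \<open>a - b = 1\<close>.\<close>

lemma cycle_poly_merge:
  assumes "m > 0"
  shows "cycle_poly (l + m) t =
    cycle_poly m t * cycle_poly (l + 1) t - t * (t - 1) * cycle_poly l t * cycle_poly (m - 1) t"
proof -
  obtain k where m: "m = Suc k" using assms by (cases m) auto
  show ?thesis
    unfolding cycle_poly_def m by (simp add: power_add) algebra
qed

text \<open>The pure powers give \<open>n\<close> equal terms. The mixed ones form two geometric
  sums, each contributing \<open>t * (t - 1) * cycle_poly n t\<close> because the bases differ by 1.
  The right side is arranged so that its last two terms are minus the derivative of
  \<open>t * (t - 1) * cycle_poly (n + 1) t\<close>.\<close>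

lemma cycle_poly_split:
  "(\<Sum>k<n. cycle_poly (k + 1) t * cycle_poly (n - k) t) =
    real (n + 1) * cycle_poly (n + 2) t - (2 * t - 1) * cycle_poly (n + 1) t
    - t * (t - 1) * real (n + 1) * cycle_poly n t"
proof -
  have geo: "(\<Sum>k<n. a ^ (k + 1) * b ^ (n - k)) = a * b * (\<Sum>k<n. b ^ (n - Suc k) * a ^ k)"
    for a b :: real
    unfolding sum_distrib_left
  proof (rule sum.cong)
    fix k assume "k \<in> {..<n}"
    then have "n - k = Suc (n - Suc k)" by auto
    then show "a ^ (k + 1) * b ^ (n - k) = a * b * (b ^ (n - Suc k) * a ^ k)" by simp
  qed simp
  have "cycle_poly (k + 1) t * cycle_poly (n - k) t =
      t ^ (n + 1) + (t - 1) ^ (n + 1)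
      - t ^ (k + 1) * (t - 1) ^ (n - k) - (t - 1) ^ (k + 1) * t ^ (n - k)" if "k < n" for k
  proof -
    have *: "x ^ (n + 1) = x ^ (k + 1) * x ^ (n - k)" for x :: real
      using that by (simp flip: power_add)
    show ?thesis unfolding cycle_poly_def * by algebra
  qed
  then have "(\<Sum>k<n. cycle_poly (k + 1) t * cycle_poly (n - k) t) =
      real n * (t ^ (n + 1) + (t - 1) ^ (n + 1))
      - t * (t - 1) * (\<Sum>k<n. (t - 1) ^ (n - Suc k) * t ^ k)
      - (t - 1) * t * (\<Sum>k<n. t ^ (n - Suc k) * (t - 1) ^ k)"
    by (simp add: sum_subtractf del: power_Suc flip: geo)
  also have "(\<Sum>k<n. (t - 1) ^ (n - Suc k) * t ^ k) = cycle_poly n t"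
    using power_diff_sumr2[of t n "t - 1"] by (simp add: cycle_poly_def)
  also have "(\<Sum>k<n. t ^ (n - Suc k) * (t - 1) ^ k) = cycle_poly n t"
    using power_diff_sumr2[of "t - 1" n t] by (simp add: cycle_poly_def)
  finally show ?thesis
    unfolding cycle_poly_def by (simp add: algebra_simps)
qed

text \<open>With \<open>a = t\<close> and \<open>b = t - 1\<close>, so that \<open>a - b = 1\<close>: merging uses
  \<open>f\<^bsub>l+m\<^esub> = f\<^sub>m f\<^bsub>l+1\<^esub> - a b f\<^sub>l f\<^bsub>m-1\<^esub>\<close> and splitting uses
  \<open>\<Sum>\<^sub>k f\<^sub>k f\<^bsub>l-k\<^esub> = l f\<^bsub>l+1\<^esub> - (a b f\<^sub>l)'\<close>. As \<open>f\<^sub>m' = m f\<^bsub>m-1\<^esub>\<close>, the correction terms add up to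
  the derivative of \<open>- a b f\<^sub>l \<Prod>\<^sub>B f\<^bsub>c B\<^esub>\<close>.\<close>

lemma cycle_weight_recurrence:
  fixes c :: "'b \<Rightarrow> nat"
  assumes R: "finite R" and c: "\<And>B. B \<in> R \<Longrightarrow> c B > 0" and l: "l > 0"
  defines "T \<equiv> \<lambda>R. image_mset c (mset_set R)"
  shows "(\<Sum>k<l - 1. cycle_weight (add_mset (k + 1) (add_mset (l - 1 - k) (T R))))
    + (\<Sum>B\<in>R. real (c B) * cycle_weight (add_mset (l + c B) (T (R - {B}))))
    = real (l + sum c R) * cycle_weight (add_mset (l + 1) (T R))"
    (is "?S1 + ?S2 = ?S3")
proof -
  define P where "P = (\<lambda>R t. \<Prod>B\<in>R. cycle_poly (c B) t)"
  have P: "(\<Prod>l\<in>#T R. cycle_poly l t) = P R t" for R t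
    by (simp add: T_def P_def prod_unfold_prod_mset multiset.map_comp comp_def)
  define \<Phi> where "\<Phi> = (\<lambda>t. - (t * (t - 1) * cycle_poly l t) * P R t)"
  define \<Phi>' where "\<Phi>' = (\<lambda>t. - ((2 * t - 1) * cycle_poly l t
      + t * (t - 1) * (real l * cycle_poly (l - 1) t)) * P R t
    + - (t * (t - 1) * cycle_poly l t) *
      (\<Sum>B\<in>R. real (c B) * cycle_poly (c B - 1) t * P (R - {B}) t))"
  have "(P R has_field_derivative
      (\<Sum>B\<in>R. real (c B) * cycle_poly (c B - 1) t * P (R - {B}) t)) (at t)" for t
    unfolding P_def by (intro has_field_derivative_prod has_field_derivative_cycle_poly)
  note [derivative_intros] = this
  have "(\<Phi> has_field_derivative \<Phi>' t) (at t)" for t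
    unfolding \<Phi>_def \<Phi>'_def
    by (auto intro!: derivative_eq_intros simp: algebra_simps)
  then have "(\<Phi>' has_integral \<Phi> 1 - \<Phi> 0) {0..1}"
    by (intro fundamental_theorem_of_calculus)
      (auto simp flip: has_real_derivative_iff_has_vector_derivative
        intro: has_field_derivative_at_within)
  \<comment> \<open>\<open>\<Phi>\<close> vanishes at both ends through its factor
    \<open>t * (t - 1)\<close>.\<close>
  then have 0: "(\<Phi>' has_integral 0) {0..1}"
    by (simp add: \<Phi>_def)
  \<comment> \<open>The difference of the two sides of the recurrence, taken under the integral; its
    integrand is then identified pointwise with \<open>\<Phi>'\<close>.\<close>
  have "((\<lambda>t. (\<Sum>k<l - 1. \<Prod>m\<in>#add_mset (k + 1) (add_mset (l - 1 - k) (T R)). cycle_poly m t)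
      + (\<Sum>B\<in>R. real (c B) * (\<Prod>m\<in>#add_mset (l + c B) (T (R - {B})). cycle_poly m t))
      - real (l + sum c R) * (\<Prod>m\<in>#add_mset (l + 1) (T R). cycle_poly m t))
      has_integral ?S1 + ?S2 - ?S3) {0..1}"
    by (intro has_integral_add has_integral_diff has_integral_sum has_integral_mult_right
        has_integral_cycle_weight finite_lessThan R)
  also have "(\<lambda>t. (\<Sum>k<l - 1. \<Prod>m\<in>#add_mset (k + 1) (add_mset (l - 1 - k) (T R)). cycle_poly m t)
      + (\<Sum>B\<in>R. real (c B) * (\<Prod>m\<in>#add_mset (l + c B) (T (R - {B})). cycle_poly m t))
      - real (l + sum c R) * (\<Prod>m\<in>#add_mset (l + 1) (T R). cycle_poly m t)) = \<Phi>'"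
  proof
    fix t
    obtain n where n: "l = Suc n" using l by (cases l) auto
    have split: "(\<Sum>k<l - 1. cycle_poly (k + 1) t * cycle_poly (l - 1 - k) t) =
        real l * cycle_poly (l + 1) t - (2 * t - 1) * cycle_poly l t
        - t * (t - 1) * real l * cycle_poly (l - 1) t"
      using cycle_poly_split[where n = n and t = t] by (simp add: n)
    have "real (c B) * (cycle_poly (l + c B) t * P (R - {B}) t) =
        real (c B) * (cycle_poly (l + 1) t * P R t)
        - t * (t - 1) * cycle_poly l t * (real (c B) * cycle_poly (c B - 1) t * P (R - {B}) t)"
      if B: "B \<in> R" for B
    proof -
      have "P R t = cycle_poly (c B) t * P (R - {B}) t"
        unfolding P_def using R B by (rule prod.remove)
      then show ?thesis
        unfolding cycle_poly_merge[OF c[OF B], of l t] by (simp add: algebra_simps)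
    qed
    then have merge: "(\<Sum>B\<in>R. real (c B) * (cycle_poly (l + c B) t * P (R - {B}) t)) =
        real (sum c R) * (cycle_poly (l + 1) t * P R t) - t * (t - 1) * cycle_poly l t *
        (\<Sum>B\<in>R. real (c B) * cycle_poly (c B - 1) t * P (R - {B}) t)"
      by (simp add: sum_subtractf sum_distrib_left sum_distrib_right)
    have "(\<Sum>k<l - 1. \<Prod>m\<in>#add_mset (k + 1) (add_mset (l - 1 - k) (T R)). cycle_poly m t) =
        (\<Sum>k<l - 1. cycle_poly (k + 1) t * cycle_poly (l - 1 - k) t) * P R t"
      by (simp add: P sum_distrib_right mult.assoc)
    then show "(\<Sum>k<l - 1. \<Prod>m\<in>#add_mset (k + 1) (add_mset (l - 1 - k) (T R)). cycle_poly m t)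
      + (\<Sum>B\<in>R. real (c B) * (\<Prod>m\<in>#add_mset (l + c B) (T (R - {B})). cycle_poly m t))
      - real (l + sum c R) * (\<Prod>m\<in>#add_mset (l + 1) (T R). cycle_poly m t) = \<Phi>' t"
      unfolding split \<Phi>'_def by (simp add: P merge) (simp add: algebra_simps)
  qed
  finally show ?thesis
    using has_integral_unique[OF 0] by fastforce
qed

subsection \<open>Cycle types\<close>

definition card_mset :: "'a set set \<Rightarrow> nat multiset" where
  "card_mset P = image_mset card (mset_set P)"

abbreviation cycle_type :: "'a set \<Rightarrow> ('a \<Rightarrow> 'a) \<Rightarrow> nat multiset" where
  "cycle_type S p \<equiv> card_mset (orbit p ` S)"

lemma card_mset_insert:
  "finite P \<Longrightarrow> C \<notin> P \<Longrightarrow> card_mset (insert C P) = add_mset (card C) (card_mset P)"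
  by (simp add: card_mset_def)

lemma card_mset_remove:
  "finite P \<Longrightarrow> C \<in> P \<Longrightarrow> card_mset P = add_mset (card C) (card_mset (P - {C}))"
  by (metis card_mset_insert insert_Diff Diff_iff finite_Diff singletonI)

lemma cycle_type_merge:
  assumes S: "finite S" and p: "p permutes S" and xy: "x \<in> S" "y \<in> S" "orbit p y \<noteq> orbit p x"
  shows "cycle_type S (transpose x y \<circ> p) =
    add_mset (card (orbit p x) + card (orbit p y))
      (card_mset (orbit p ` S - {orbit p x} - {orbit p y}))"
proof -
  \<comment> \<open>The merged cycle is new: an orbit equal to the union would contain
    \<open>x\<close> and hence be \<open>orbit p x\<close>, which has been removed.\<close>
  have "orbit p x \<union> orbit p y \<notin> orbit p ` S - {orbit p x} - {orbit p y}"
  proof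
    assume *: "orbit p x \<union> orbit p y \<in> orbit p ` S - {orbit p x} - {orbit p y}"
    then obtain z where z: "orbit p x \<union> orbit p y = orbit p z" by auto
    then have "x \<in> orbit p z" using permutes_self_in_orbit[OF S p, of x] by auto
    then have "orbit p x = orbit p z" by (rule permutes_orbit_eq[OF S p])
    with * z show False by simp
  qed
  moreover have "card (orbit p x \<union> orbit p y) = card (orbit p x) + card (orbit p y)"
    using finite_permutes_orbit[OF S p] permutes_orbit_disjoint[OF S p, of x y] xy(3)
    by (intro card_Un_disjoint) auto
  ultimately show ?thesis
    unfolding orbits_merge[OF assms] using S by (simp add: card_mset_insert)
qed

lemma cycle_type_split:
  assumes S: "finite S" and p: "p permutes S" and x: "x \<in> S"
    and t: "traverses p x (xs @ y # ys)" "set (x # xs @ y # ys) = orbit p x"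
  shows "cycle_type S (transpose x y \<circ> p) =
    add_mset (Suc (length xs)) (add_mset (Suc (length ys)) (card_mset (orbit p ` S - {orbit p x})))"
proof -
  have d: "distinct (x # xs)" "distinct (y # ys)" "x \<notin> set (y # ys)"
    using t(1) by (auto simp: traverses_def)
  \<comment> \<open>A set meeting \<open>orbit p x\<close> is none of the other orbits, so both
    halves of the cut cycle are new and are counted separately.\<close>
  have notin: "C \<notin> orbit p ` S - {orbit p x}" if "z \<in> C" "z \<in> orbit p x" for z C
  proof
    assume *: "C \<in> orbit p ` S - {orbit p x}"
    then obtain w where w: "C = orbit p w" by auto
    have "orbit p z = orbit p x" by (rule permutes_orbit_eq[OF S p that(2)])
    moreover have "orbit p z = orbit p w"
      by (rule permutes_orbit_eq[OF S p]) (use that w in simp)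
    ultimately show False using * w by simp
  qed
  have "set (x # xs) \<notin> insert (set (y # ys)) (orbit p ` S - {orbit p x})"
    using notin[of x "set (x # xs)"] t(2) d(3) by auto
  moreover have "set (y # ys) \<notin> orbit p ` S - {orbit p x}"
    using notin[of y "set (y # ys)"] t(2) by auto
  moreover have "card (set (x # xs)) = Suc (length xs)" "card (set (y # ys)) = Suc (length ys)"
    using d by (simp_all only: distinct_card list.size)
  ultimately show ?thesis
    unfolding orbits_split[OF assms] using S
    by (simp only: card_mset_insert finite_insert finite_Diff finite_imageI not_False_eq_True)
qed

section \<open>Inserting a new point into a permutation\<close>

lemma orbits_insert_fixpoint:
  assumes "p permutes S" "a \<notin> S"
  shows "orbit p ` insert a S = insert {a} (orbit p ` S)" "{a} \<notin> orbit p ` S"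
proof -
  have "orbit p a = {a}"
    using assms by (simp add: orbit_eq_singleton_iff permutes_not_in)
  then show "orbit p ` insert a S = insert {a} (orbit p ` S)" by simp
  show "{a} \<notin> orbit p ` S" using permutes_orbit_subset[OF assms(1)] assms(2) by blast
qed

lemma cycle_type_insert_fixpoint:
  assumes "finite S" "p permutes S" "a \<notin> S"
  shows "cycle_type (insert a S) p = add_mset 1 (cycle_type S p)"
  unfolding orbits_insert_fixpoint(1)[OF assms(2,3)]
  using orbits_insert_fixpoint(2)[OF assms(2,3)] assms(1) by (simp add: card_mset_insert)

text \<open>On \<open>insert a S\<close> the point \<open>a\<close> is fixed by \<open>p\<close>, so
  this is the merge of the cycle \<open>{a}\<close> with the cycle of \<open>y\<close>.\<close>

lemma cycle_type_insert:
  assumes S: "finite S" and p: "p permutes S" and a: "a \<notin> S" and y: "y \<in> S"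
  shows "cycle_type (insert a S) (transpose a y \<circ> p) =
    add_mset (card (orbit p y) + 1) (card_mset (orbit p ` S - {orbit p y}))"
proof -
  have oa: "orbit p a = {a}"
    using p a by (simp add: orbit_eq_singleton_iff permutes_not_in)
  have "orbit p y \<noteq> orbit p a"
    unfolding oa using orbits_insert_fixpoint(2)[OF p a] y by auto
  moreover have "p permutes insert a S" using p by (rule permutes_imp_permutes_insert)
  ultimately have "cycle_type (insert a S) (transpose a y \<circ> p) =
    add_mset (card (orbit p a) + card (orbit p y))
      (card_mset (orbit p ` insert a S - {orbit p a} - {orbit p y}))"
    using S y by (intro cycle_type_merge) auto
  also have "orbit p ` insert a S - {orbit p a} = orbit p ` S"
    unfolding orbits_insert_fixpoint(1)[OF p a] oa using orbits_insert_fixpoint(2)[OF p a] by simp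
  also have "card (orbit p a) + card (orbit p y) = card (orbit p y) + 1" by (simp add: oa)
  finally show ?thesis .
qed

text \<open>The recurrence in terms of permutations. Points \<open>y\<close> on the cycle of
  \<open>x\<close> cut it, once at each position; each other cycle \<open>C\<close> is merged with
  it by \<open>card C\<close> choices of \<open>y\<close>. The right side is the weight after a new
  point has been inserted into the cycle of \<open>x\<close>.\<close>

lemma sum_cycle_weight_transpose:
  assumes S: "finite S" and p: "p permutes S" and x: "x \<in> S"
  shows "(\<Sum>y\<in>S - {x}. cycle_weight (cycle_type S (transpose x y \<circ> p))) =
    real (card S) * cycle_weight (add_mset (card (orbit p x) + 1) (card_mset (orbit p ` S - {orbit p x})))"
proof -
  define R where "R = orbit p ` S - {orbit p x}"
  define l where "l = card (orbit p x)"
  define g where "g = (\<lambda>y. cycle_weight (cycle_type S (transpose x y \<circ> p)))"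
  \<comment> \<open>Setting the value at \<open>x\<close> to 0 extends the sum to all of
    \<open>S\<close>, where it can be grouped by orbits.\<close>
  define h where "h = (\<lambda>y. if y = x then 0 else g y)"
  have R: "finite R" using S by (simp add: R_def)
  have O: "orbit p ` S = insert (orbit p x) R" "orbit p x \<notin> R"
    using x by (auto simp: R_def)
  have "(\<Sum>y\<in>S - {x}. g y) = (\<Sum>y\<in>S. h y)"
    using sum.remove[OF S x, of h] by (simp add: h_def)
  also have "\<dots> = (\<Sum>C\<in>orbit p ` S. \<Sum>y\<in>C. h y)"
    by (rule sum_over_orbits[OF S p])
  also have "\<dots> = (\<Sum>y\<in>orbit p x. h y) + (\<Sum>C\<in>R. \<Sum>y\<in>C. h y)"
    unfolding O(1) using R O(2) by (rule sum.insert)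
  also have "(\<Sum>C\<in>R. \<Sum>y\<in>C. h y) =
      (\<Sum>C\<in>R. real (card C) * cycle_weight (add_mset (l + card C) (card_mset (R - {C}))))"
  proof (rule sum.cong)
    fix C assume C: "C \<in> R"
    have "h y = cycle_weight (add_mset (l + card C) (card_mset (R - {C})))" if y: "y \<in> C" for y
    proof -
      obtain z where z: "z \<in> S" "C = orbit p z" using C by (auto simp: R_def)
      have yS: "y \<in> S" using permutes_orbit_subset[OF p] z y by auto
      have "orbit p y = C" unfolding z(2) by (rule permutes_orbit_eq[OF S p]) (use y z in simp)
      moreover from this have "orbit p y \<noteq> orbit p x" using C by (simp add: R_def)
      ultimately show ?thesis
        using cycle_type_merge[OF S p x yS] by (auto simp: h_def g_def l_def R_def)
    qed
    then show "(\<Sum>y\<in>C. h y) =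
        real (card C) * cycle_weight (add_mset (l + card C) (card_mset (R - {C})))"
      by simp
  qed simp
  also have "(\<Sum>y\<in>orbit p x. h y) =
      (\<Sum>k<l - 1. cycle_weight (add_mset (k + 1) (add_mset (l - 1 - k) (card_mset R))))"
  proof -
    obtain xs where xs: "traverses p x xs" "set (x # xs) = orbit p x"
      by (rule traverses_exists[OF permutes_self_in_orbit[OF S p]])
    have d: "distinct xs" "x \<notin> set xs" using xs(1) by (auto simp: traverses_def)
    have l: "l = Suc (length xs)" unfolding l_def xs(2)[symmetric] using d by (simp add: distinct_card)
    have "(\<Sum>y\<in>orbit p x. h y) = h x + (\<Sum>y\<in>set xs. h y)"
      unfolding xs(2)[symmetric] using d by simp
    also have "\<dots> = (\<Sum>y\<in>set xs. g y)"
      using d by (auto simp: h_def intro!: sum.cong)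
    also have "\<dots> = (\<Sum>k<length xs. g (xs ! k))"
      using sum.reindex_bij_betw[OF bij_betw_nth[OF d(1) refl refl], of g] by simp
    also have "\<dots> = (\<Sum>k<l - 1. cycle_weight (add_mset (k + 1) (add_mset (l - 1 - k) (card_mset R))))"
    proof (rule sum.cong)
      fix k assume "k \<in> {..<l - 1}"
      then have k: "k < length xs" by (simp add: l)
      \<comment> \<open>The cut before \<open>xs ! k\<close> leaves \<open>k + 1\<close> points in
        the cycle of \<open>x\<close> and \<open>length xs - k = l - 1 - k\<close> points in the
        other.\<close>
      have "cycle_type S (transpose x (xs ! k) \<circ> p) = add_mset (Suc (length (take k xs)))
          (add_mset (Suc (length (drop (Suc k) xs))) (card_mset R))"
        unfolding R_def using xs id_take_nth_drop[OF k] by (intro cycle_type_split[OF S p x]) simp_all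
      then show "g (xs ! k) = cycle_weight (add_mset (k + 1) (add_mset (l - 1 - k) (card_mset R)))"
        using k by (simp add: g_def l Suc_diff_Suc)
    qed (simp add: l)
    finally show ?thesis .
  qed
  also have "(\<Sum>k<l - 1. cycle_weight (add_mset (k + 1) (add_mset (l - 1 - k) (card_mset R))))
      + (\<Sum>C\<in>R. real (card C) * cycle_weight (add_mset (l + card C) (card_mset (R - {C}))))
      = real (l + sum card R) * cycle_weight (add_mset (l + 1) (card_mset R))"
  proof -
    have "card C > 0" if "C \<in> R" for C
      using that card_orbit_pos[OF S p] unfolding R_def by (elim DiffE imageE) simp
    moreover have "l > 0" unfolding l_def by (rule card_orbit_pos[OF S p])
    ultimately show ?thesis
      unfolding card_mset_def by (intro cycle_weight_recurrence[OF R])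
  qed
  also have "l + sum card R = card S"
    using sum_card_orbits[OF S p] R O by (simp add: l_def)
  finally show ?thesis by (simp add: g_def l_def R_def)
qed

subsection \<open>Products of two full cycles\<close>

text \<open>Full cycles on an arbitrary set rather than on \<open>{1..N}\<close>, so that inductions
  can insert one point at a time.\<close>

definition cycles_on :: "'a set \<Rightarrow> ('a \<Rightarrow> 'a) set" where
  "cycles_on S = {p. p permutes S \<and> cyclic_on p S}"

lemma finite_cycles_on: "finite S \<Longrightarrow> finite (cycles_on S)"
  unfolding cycles_on_def by (rule finite_subset[OF _ finite_permutations]) auto

lemma cyclic_on_iff_cycle_type:
  assumes S: "finite S" "S \<noteq> {}" and p: "p permutes S"
  shows "cyclic_on p S \<longleftrightarrow> cycle_type S p = {#card S#}"
proof
  assume c: "cyclic_on p S"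
  then have "orbit p ` S = {S}"
    by (intro orbit_image_eqI) auto
  then show "cycle_type S p = {#card S#}" by (simp add: card_mset_def)
next
  assume "cycle_type S p = {#card S#}"
  then have "card (orbit p ` S) = 1"
    unfolding card_mset_def by (metis size_image_mset size_mset_set size_single)
  then obtain C where C: "orbit p ` S = {C}" by (rule card_1_singletonE)
  then have "S = C" using Union_orbits[OF S(1) p] by simp
  with C S(2) have "S \<in> orbit p ` S" by simp
  then show "cyclic_on p S" using cyclic_on_orbit[OF p S(1)] by (metis imageE)
qed

text \<open>Inserting \<open>a\<close> lengthens one cycle and keeps the others, so there is a
  single cycle afterwards exactly if there was one before.\<close>

lemma cyclic_on_insert_iff:
  assumes S: "finite S" and a: "a \<notin> S" and q: "q permutes S" and b: "b \<in> S"
  shows "cyclic_on (transpose a b \<circ> q) (insert a S) \<longleftrightarrow> cyclic_on q S"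
proof -
  have "transpose a b \<circ> q permutes insert a S"
    using q b by (intro permutes_compose permutes_swap_id permutes_imp_permutes_insert) auto
  then have "cyclic_on (transpose a b \<circ> q) (insert a S) \<longleftrightarrow>
      add_mset (card (orbit q b) + 1) (card_mset (orbit q ` S - {orbit q b})) = {#card S + 1#}"
    using cyclic_on_iff_cycle_type[of "insert a S" "transpose a b \<circ> q"] S a
    unfolding cycle_type_insert[OF S q a b] by simp
  also have "\<dots> \<longleftrightarrow> cycle_type S q = {#card S#}"
    using S b by (subst (2) card_mset_remove[of _ "orbit q b"]) auto
  also have "\<dots> \<longleftrightarrow> cyclic_on q S"
    using cyclic_on_iff_cycle_type[OF S _ q] b by auto
  finally show ?thesis .
qed

text \<open>Every permutation of \<open>insert a S\<close> is \<open>transpose a b \<circ> q\<close>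
  with \<open>q\<close> permuting \<open>S\<close>. The case \<open>b = a\<close> drops out, since a
  permutation fixing \<open>a\<close> is no full cycle when \<open>S\<close> is nonempty.\<close>

lemma sum_cycles_on_insert:
  fixes f :: "('a \<Rightarrow> 'a) \<Rightarrow> 'b :: comm_monoid_add"
  assumes S: "finite S" "S \<noteq> {}" and a: "a \<notin> S"
  shows "(\<Sum>p\<in>cycles_on (insert a S). f p) = (\<Sum>b\<in>S. \<Sum>q\<in>cycles_on S. f (transpose a b \<circ> q))"
proof -
  have restrict: "(\<Sum>p\<in>cycles_on T. g p) = (\<Sum>p | p permutes T. if cyclic_on p T then g p else 0)"
    if "finite T" for T and g :: "('a \<Rightarrow> 'a) \<Rightarrow> 'b"
    unfolding cycles_on_def
    using sum.inter_filter[OF finite_permutations[OF that], of g "\<lambda>p. cyclic_on p T"] by simp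
  have not_cyclic: "\<not> cyclic_on q (insert a S)" if q: "q permutes S" for q
  proof
    assume "cyclic_on q (insert a S)"
    then have "orbit q a = insert a S" by (rule orbit_cyclic_eq3) simp
    moreover have "orbit q a = {a}"
      using q a by (simp add: orbit_eq_singleton_iff permutes_not_in)
    ultimately show False using S a by auto
  qed
  have "(\<Sum>p\<in>cycles_on (insert a S). f p) =
      (\<Sum>b\<in>insert a S. \<Sum>q | q permutes S. if cyclic_on (transpose a b \<circ> q) (insert a S)
        then f (transpose a b \<circ> q) else 0)"
    unfolding restrict[OF finite.insertI[OF S(1)]] by (rule sum_over_permutations_insert[OF S(1) a])
  also have "\<dots> = (\<Sum>b\<in>S. \<Sum>q | q permutes S. if cyclic_on (transpose a b \<circ> q) (insert a S)
        then f (transpose a b \<circ> q) else 0)"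
    using S a not_cyclic by (simp add: sum.insert)
  also have "\<dots> = (\<Sum>b\<in>S. \<Sum>q | q permutes S. if cyclic_on q S
        then f (transpose a b \<circ> q) else 0)"
    using S a by (intro sum.cong refl) (simp add: cyclic_on_insert_iff)
  finally show ?thesis using S by (simp only: restrict)
qed

lemma cycles_on_singleton: "cycles_on {x} = {id}"
proof -
  have "cyclic_on id {x}"
    by (rule cyclic_on_singleI[of x]) (use orbit_eq_singleton_iff[of id x] in auto)
  then show ?thesis by (auto simp: cycles_on_def)
qed

lemma card_cycles_on: "finite S \<Longrightarrow> S \<noteq> {} \<Longrightarrow> card (cycles_on S) = fact (card S - 1)"
proof (induction S rule: finite_ne_induct)
  case (singleton x)
  then show ?case by (simp add: cycles_on_singleton)
next
  case (insert a S)
  have "card (cycles_on (insert a S)) = (\<Sum>b\<in>S. card (cycles_on S))"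
    using sum_cycles_on_insert[OF insert.hyps(1-3), of "\<lambda>_. 1 :: nat"] by simp
  also have "\<dots> = card S * fact (card S - 1)" by (simp add: insert.IH)
  also have "\<dots> = fact (card S)"
    using insert.hyps by (simp add: fact_reduce card_gt_0_iff)
  finally show ?case using insert.hyps by simp
qed

text \<open>For \<open>i \<noteq> j\<close> the 3-cycle is rewritten so that
  \<open>transpose j i\<close> acts inside \<open>S\<close> and only the leftmost factor inserts
  \<open>a\<close>.\<close>

lemma transpose_comp_transpose:
  assumes "i \<noteq> a" "j \<noteq> a"
  shows "transpose a i \<circ> transpose a j = (if i = j then id else transpose a j \<circ> transpose j i)"
  using assms by (auto simp: fun_eq_iff Transposition.transpose_def)

lemma sum_cycles_on_pairs_insert:
  fixes \<phi> :: "('a \<Rightarrow> 'a) \<Rightarrow> real"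
  assumes S: "finite S" "S \<noteq> {}" and a: "a \<notin> S"
  shows "(\<Sum>p1\<in>cycles_on (insert a S). \<Sum>p2\<in>cycles_on (insert a S). \<phi> (p1 \<circ> p2)) =
    (\<Sum>q1\<in>cycles_on S. \<Sum>q2\<in>cycles_on S. real (card S) * \<phi> (q1 \<circ> q2) +
      (\<Sum>j\<in>S. \<Sum>i\<in>S - {j}. \<phi> (transpose a j \<circ> (transpose j i \<circ> (q1 \<circ> q2)))))"
proof -
  have "(\<Sum>p1\<in>cycles_on (insert a S). \<Sum>p2\<in>cycles_on (insert a S). \<phi> (p1 \<circ> p2)) =
    (\<Sum>i\<in>S. \<Sum>q1\<in>cycles_on S. \<Sum>j\<in>S. \<Sum>q2\<in>cycles_on S.
      \<phi> ((transpose a i \<circ> q1) \<circ> (transpose a j \<circ> q2)))"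
    by (simp only: sum_cycles_on_insert[OF S a])
  also have "\<dots> = (\<Sum>i\<in>S. \<Sum>q1\<in>cycles_on S. \<Sum>j\<in>S. \<Sum>q2\<in>cycles_on S.
      \<phi> (transpose a i \<circ> transpose a j \<circ> (q1 \<circ> q2)))"
  proof (rule sum.cong[OF refl], rule sum.cong[OF refl])
    fix i q1 assume q1: "q1 \<in> cycles_on S"
    then have q1p: "q1 permutes S" by (simp add: cycles_on_def)
    then have q1a: "q1 a = a" using a by (simp add: permutes_not_in)
    \<comment> \<open>Conjugation by \<open>q1\<close>, which fixes \<open>a\<close>. Since
      \<open>q1\<close> permutes \<open>S\<close>, summing over \<open>q1 j\<close> is then the same
      as summing over \<open>j\<close>.\<close>
    have "q1 \<circ> transpose a j = transpose a (q1 j) \<circ> q1" for j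
      using bij_is_inj[OF permutes_bij[OF q1p]] q1a
      by (auto simp: fun_eq_iff Transposition.transpose_def inj_eq)
    then have eq: "(transpose a i \<circ> q1) \<circ> (transpose a j \<circ> q2) =
        transpose a i \<circ> transpose a (q1 j) \<circ> (q1 \<circ> q2)" for j q2
      by (metis comp_assoc)
    show "(\<Sum>j\<in>S. \<Sum>q2\<in>cycles_on S. \<phi> ((transpose a i \<circ> q1) \<circ> (transpose a j \<circ> q2))) =
      (\<Sum>j\<in>S. \<Sum>q2\<in>cycles_on S. \<phi> (transpose a i \<circ> transpose a j \<circ> (q1 \<circ> q2)))"
      unfolding eq by (rule sum.reindex_bij_betw[OF permutes_imp_bij[OF q1p]])
  qed
  also have "\<dots> = (\<Sum>q1\<in>cycles_on S. \<Sum>q2\<in>cycles_on S. \<Sum>j\<in>S. \<Sum>i\<in>S.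
      \<phi> (transpose a i \<circ> transpose a j \<circ> (q1 \<circ> q2)))"
    by (subst sum.swap, intro sum.cong refl, subst sum.swap, subst (2) sum.swap,
        subst sum.swap, rule refl)
  also have "\<dots> = (\<Sum>q1\<in>cycles_on S. \<Sum>q2\<in>cycles_on S. real (card S) * \<phi> (q1 \<circ> q2) +
      (\<Sum>j\<in>S. \<Sum>i\<in>S - {j}. \<phi> (transpose a j \<circ> (transpose j i \<circ> (q1 \<circ> q2)))))"
  proof (intro sum.cong refl)
    fix q1 q2
    have "(\<Sum>i\<in>S. \<phi> (transpose a i \<circ> transpose a j \<circ> (q1 \<circ> q2))) = \<phi> (q1 \<circ> q2) +
      (\<Sum>i\<in>S - {j}. \<phi> (transpose a j \<circ> (transpose j i \<circ> (q1 \<circ> q2))))" if j: "j \<in> S" for j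
    proof -
      have "i \<noteq> a" if "i \<in> S" for i using that a by auto
      then show ?thesis
        unfolding sum.remove[OF S(1) j]
        using j by (auto simp: transpose_comp_transpose comp_assoc intro!: sum.cong)
    qed
    then show "(\<Sum>j\<in>S. \<Sum>i\<in>S. \<phi> (transpose a i \<circ> transpose a j \<circ> (q1 \<circ> q2))) =
      real (card S) * \<phi> (q1 \<circ> q2) +
      (\<Sum>j\<in>S. \<Sum>i\<in>S - {j}. \<phi> (transpose a j \<circ> (transpose j i \<circ> (q1 \<circ> q2))))"
      by (simp add: sum.distrib)
  qed
  finally show ?thesis .
qed

text \<open>An arbitrary test function \<open>\<phi>\<close> is needed for the induction, which
  applies the hypothesis to another function \<open>\<psi>\<close> on the permutations of
  \<open>S\<close>. An indicator for \<open>\<phi>\<close> gives counts of factorizations.\<close>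

lemma sum_cycles_on_pairs:
  fixes \<phi> :: "('a \<Rightarrow> 'a) \<Rightarrow> real"
  shows "finite S \<Longrightarrow> S \<noteq> {} \<Longrightarrow>
    (\<Sum>p1\<in>cycles_on S. \<Sum>p2\<in>cycles_on S. \<phi> (p1 \<circ> p2)) =
    fact (card S - 1) * (\<Sum>p | p permutes S. \<phi> p * cycle_weight (cycle_type S p))"
proof (induction S arbitrary: \<phi> rule: finite_ne_induct)
  case (singleton x)
  have "orbit id x = {x}" by (simp add: orbit_eq_singleton_iff)
  then have "cycle_weight (cycle_type {x} id) = 1"
    by (simp add: card_mset_def cycle_weight_def)
  moreover have "{p. p permutes {x}} = {id}" by auto
  ultimately show ?case by (simp add: cycles_on_singleton flip: id_def)
next
  case (insert a S)
  define n where "n = card S"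
  have n: "n > 0" using insert.hyps by (simp add: n_def card_gt_0_iff)
  define W where "W = (\<lambda>p. cycle_weight (cycle_type S p))"
  define \<psi> where "\<psi> = (\<lambda>q. real n * \<phi> q +
    (\<Sum>j\<in>S. \<Sum>i\<in>S - {j}. \<phi> (transpose a j \<circ> (transpose j i \<circ> q))))"
  have "(\<Sum>p1\<in>cycles_on (insert a S). \<Sum>p2\<in>cycles_on (insert a S). \<phi> (p1 \<circ> p2)) =
      (\<Sum>q1\<in>cycles_on S. \<Sum>q2\<in>cycles_on S. \<psi> (q1 \<circ> q2))"
    unfolding \<psi>_def n_def by (rule sum_cycles_on_pairs_insert[OF insert.hyps(1-3)])
  also have "\<dots> = fact (n - 1) * (\<Sum>q | q permutes S. \<psi> q * W q)"
    unfolding W_def n_def by (rule insert.IH)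
  also have "(\<Sum>q | q permutes S. \<psi> q * W q) =
      real n * (\<Sum>q | q permutes S. \<phi> q * W q) +
      (\<Sum>j\<in>S. \<Sum>i\<in>S - {j}. \<Sum>q | q permutes S. \<phi> (transpose a j \<circ> (transpose j i \<circ> q)) * W q)"
    unfolding \<psi>_def distrib_right sum.distrib sum_distrib_left sum_distrib_right mult.assoc
    by (rule arg_cong2[where f = "(+)"], rule refl, rule trans[OF sum.swap],
        rule sum.cong[OF refl], rule sum.swap)
  \<comment> \<open>Substituting \<open>transpose j i \<circ> q\<close> for \<open>q\<close>, an
    involution on the permutations of \<open>S\<close>, moves this transposition from
    \<open>\<phi>\<close> to \<open>W\<close>, where the sum over \<open>i\<close> is known.\<close>
  also have "(\<Sum>j\<in>S. \<Sum>i\<in>S - {j}. \<Sum>q | q permutes S. \<phi> (transpose a j \<circ> (transpose j i \<circ> q)) * W q) =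
      (\<Sum>j\<in>S. \<Sum>i\<in>S - {j}. \<Sum>q | q permutes S. \<phi> (transpose a j \<circ> q) * W (transpose j i \<circ> q))"
  proof (rule sum.cong[OF refl], rule sum.cong[OF refl])
    fix j i assume ij: "j \<in> S" "i \<in> S - {j}"
    then have t: "transpose j i permutes S" by (auto intro: permutes_swap_id)
    have tt: "transpose j i \<circ> (transpose j i \<circ> q) = q" for q
      by (simp add: fun_eq_iff)
    show "(\<Sum>q | q permutes S. \<phi> (transpose a j \<circ> (transpose j i \<circ> q)) * W q) =
      (\<Sum>q | q permutes S. \<phi> (transpose a j \<circ> q) * W (transpose j i \<circ> q))"
      by (rule sum.reindex_bij_witness[of _ "(\<circ>) (transpose j i)" "(\<circ>) (transpose j i)"])
        (simp_all only: mem_Collect_eq tt permutes_compose[OF _ t])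
  qed
  also have "\<dots> = (\<Sum>j\<in>S. \<Sum>q | q permutes S. \<phi> (transpose a j \<circ> q) *
      (\<Sum>i\<in>S - {j}. W (transpose j i \<circ> q)))"
    unfolding sum_distrib_left by (intro sum.cong refl, rule sum.swap)
  also have "\<dots> = (\<Sum>j\<in>S. \<Sum>q | q permutes S. \<phi> (transpose a j \<circ> q) *
      (real n * cycle_weight (cycle_type (insert a S) (transpose a j \<circ> q))))"
    using insert.hyps unfolding W_def n_def
    by (intro sum.cong refl) (simp add: sum_cycle_weight_transpose cycle_type_insert del: image_insert)
  \<comment> \<open>A new fixed point contributes the factor \<open>cycle_poly 1 t = 1\<close>, so
    it leaves the weight unchanged.\<close>
  also have "(\<Sum>q | q permutes S. \<phi> q * W q) =
      (\<Sum>q | q permutes S. \<phi> q * cycle_weight (cycle_type (insert a S) q))"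
    using insert.hyps unfolding W_def
    by (intro sum.cong refl) (simp add: cycle_type_insert_fixpoint del: image_insert)
  \<comment> \<open>The permutations fixing \<open>a\<close> and those of the form
    \<open>transpose a j \<circ> q\<close> with \<open>j\<close> in \<open>S\<close> together
    exhaust the permutations of \<open>insert a S\<close>.\<close>
  also have "real n * \<dots> + (\<Sum>j\<in>S. \<Sum>q | q permutes S. \<phi> (transpose a j \<circ> q) *
      (real n * cycle_weight (cycle_type (insert a S) (transpose a j \<circ> q)))) =
      real n * (\<Sum>p | p permutes insert a S. \<phi> p * cycle_weight (cycle_type (insert a S) p))"
    unfolding sum_over_permutations_insert[OF insert.hyps(1,3)] sum.insert[OF insert.hyps(1,3)]
    by (simp add: distrib_left sum_distrib_left mult.left_commute del: image_insert)
  finally show ?case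
    using n insert.hyps by (simp add: n_def[symmetric] fact_reduce[of n] del: image_insert)
qed

subsection \<open>The number of permutations of a given cycle type\<close>

text \<open>For positive parts, the order of the centralizer of a permutation of cycle type
  \<open>M\<close>.\<close>

definition centralizer_size :: "nat multiset \<Rightarrow> real" where
  "centralizer_size M = (\<Prod>l\<in>set_mset M. real l ^ count M l * fact (count M l))"

lemma centralizer_size_add_mset:
  "centralizer_size (add_mset l M) = real l * real (count M l + 1) * centralizer_size M"
proof -
  define f where "f = (\<lambda>M k. real k ^ count M k * fact (count M k) :: real)"
  \<comment> \<open>A part of multiplicity 0 contributes the factor 1, so both products can be taken
    over one index set and differ only at \<open>l\<close>.\<close>
  have ext: "centralizer_size M' = f M' l * (\<Prod>k\<in>set_mset M - {l}. f M' k)"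
    if "set_mset M' \<subseteq> insert l (set_mset M)" for M'
  proof -
    have "centralizer_size M' = (\<Prod>k\<in>insert l (set_mset M). f M' k)"
      unfolding centralizer_size_def f_def using that
      by (intro prod.mono_neutral_left) (auto simp: not_in_iff)
    then show ?thesis by (simp add: prod.insert_remove)
  qed
  have "centralizer_size (add_mset l M) =
      f (add_mset l M) l * (\<Prod>k\<in>set_mset M - {l}. f (add_mset l M) k)"
    by (rule ext) simp
  also have "(\<Prod>k\<in>set_mset M - {l}. f (add_mset l M) k) = (\<Prod>k\<in>set_mset M - {l}. f M k)"
    by (intro prod.cong) (auto simp: f_def)
  also have "f (add_mset l M) l = real l * real (count M l + 1) * f M l"
    by (simp add: f_def)
  also have "real l * real (count M l + 1) * f M l * (\<Prod>k\<in>set_mset M - {l}. f M k) =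
      real l * real (count M l + 1) * centralizer_size M"
    by (subst ext[of M]) auto
  finally show ?thesis .
qed

lemma count_card_mset: "finite P \<Longrightarrow> count (card_mset P) l = card {C \<in> P. card C = l}"
proof (induction P rule: finite_induct)
  case (insert C P)
  have "{D \<in> insert C P. card D = l} =
      (if card C = l then insert C {D \<in> P. card D = l} else {D \<in> P. card D = l})"
    by auto
  then show ?case using insert by (simp add: card_mset_insert)
qed (simp add: card_mset_def)

text \<open>Read with \<open>k\<close> as the new size of the cycle \<open>C\<close>: the old type
  is recovered by replacing one part \<open>k\<close> of \<open>M\<close> by
  \<open>card C\<close>.\<close>

lemma card_mset_eq_iff_merge:
  "finite P \<Longrightarrow> C \<in> P \<Longrightarrow>
    add_mset k (card_mset (P - {C})) = M \<longleftrightarrow> k \<in># M \<and> card_mset P = add_mset (card C) (M - {#k#})"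
  by (auto simp: card_mset_remove[of P C])

lemma card_elements_orbit_size:
  assumes S: "finite S" and p: "p permutes S"
  shows "card {x \<in> S. card (orbit p x) = l} = l * count (cycle_type S p) l"
proof -
  have "card {x \<in> S. card (orbit p x) = l} = (\<Sum>x\<in>S. of_bool (card (orbit p x) = l))"
    using S by (simp add: of_bool_def sum.If_cases Int_def)
  also have "\<dots> = (\<Sum>C\<in>orbit p ` S. \<Sum>x\<in>C. of_bool (card (orbit p x) = l))"
    by (rule sum_over_orbits[OF S p])
  also have "\<dots> = (\<Sum>C\<in>orbit p ` S. if card C = l then l else 0)"
  proof (rule sum.cong[OF refl])
    fix C assume "C \<in> orbit p ` S"
    then obtain z where z: "C = orbit p z" by auto
    have "orbit p x = C" if "x \<in> C" for x
      using permutes_orbit_eq[OF S p, of x z] that z by simp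
    then have "(\<Sum>x\<in>C. of_bool (card (orbit p x) = l)) = (\<Sum>x\<in>C. of_bool (card C = l) :: nat)"
      by (intro sum.cong) simp_all
    then show "(\<Sum>x\<in>C. of_bool (card (orbit p x) = l)) = (if card C = l then l else 0)"
      by simp
  qed
  also have "\<dots> = l * count (cycle_type S p) l"
    using S by (simp add: count_card_mset sum.If_cases Int_def mult.commute)
  finally show ?thesis .
qed

text \<open>For \<open>k > 0\<close>, \<open>M' k\<close> is the type left when \<open>a\<close> is
  deleted from a cycle of length \<open>k\<close>. The coefficient counts the ways back: only
  \<open>b = a\<close> for \<open>k = 1\<close>; otherwise any point on the cycles of length
  \<open>k - 1\<close>, of which \<open>M' k\<close> has one more than \<open>M\<close>.\<close>

lemma sum_of_bool_cycle_type_insert: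
  fixes M :: "nat multiset"
  assumes S: "finite S" and p: "p permutes S" and a: "a \<notin> S"
  defines "M' \<equiv> \<lambda>k. if k = 1 then M - {#1#} else add_mset (k - 1) (M - {#k#})"
  shows "(\<Sum>b\<in>insert a S. of_bool (cycle_type (insert a S) (transpose a b \<circ> p) = M)) =
    (\<Sum>k\<in>set_mset M. (if k = 1 then 1 else real (k - 1) * real (count M (k - 1) + 1)) *
      of_bool (cycle_type S p = M' k))"
proof -
  define g where "g = (\<lambda>k. of_bool (cycle_type S p = M' k) :: real)"
  have "(\<Sum>b\<in>insert a S. of_bool (cycle_type (insert a S) (transpose a b \<circ> p) = M)) =
      of_bool (cycle_type (insert a S) p = M) +
      (\<Sum>b\<in>S. of_bool (cycle_type (insert a S) (transpose a b \<circ> p) = M) :: real)"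
    using S a by (simp add: sum.insert del: image_insert)
  also have "cycle_type (insert a S) p = M \<longleftrightarrow> 1 \<in># M \<and> cycle_type S p = M' 1"
    unfolding cycle_type_insert_fixpoint[OF S p a] M'_def by auto
  also have "of_bool (1 \<in># M \<and> cycle_type S p = M' 1) = (\<Sum>k\<in>set_mset M. if k = 1 then g k else 0)"
    by (simp add: g_def)
  also have "(\<Sum>b\<in>S. of_bool (cycle_type (insert a S) (transpose a b \<circ> p) = M) :: real) =
      (\<Sum>b\<in>S. \<Sum>k\<in>set_mset M. if k = card (orbit p b) + 1 then g k else 0)"
  proof (rule sum.cong[OF refl])
    fix b assume b: "b \<in> S"
    have "card (orbit p b) > 0" by (rule card_orbit_pos[OF S p])
    then have "cycle_type (insert a S) (transpose a b \<circ> p) = M \<longleftrightarrow>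
        card (orbit p b) + 1 \<in># M \<and> cycle_type S p = M' (card (orbit p b) + 1)"
      unfolding cycle_type_insert[OF S p a b] M'_def
      using S b by (subst card_mset_eq_iff_merge) simp_all
    then show "of_bool (cycle_type (insert a S) (transpose a b \<circ> p) = M) =
        (\<Sum>k\<in>set_mset M. if k = card (orbit p b) + 1 then g k else 0)"
      by (simp add: g_def)
  qed
  also have "\<dots> = (\<Sum>k\<in>set_mset M. \<Sum>b\<in>S. if k = card (orbit p b) + 1 then g k else 0)"
    by (rule sum.swap)
  also have "\<dots> = (\<Sum>k\<in>set_mset M. real (card {b \<in> S. k = card (orbit p b) + 1}) * g k)"
    by (simp only: sum.inter_filter[OF S, symmetric] sum_constant)
  also have "(\<Sum>k\<in>set_mset M. if k = 1 then g k else 0) +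
      (\<Sum>k\<in>set_mset M. real (card {b \<in> S. k = card (orbit p b) + 1}) * g k) =
      (\<Sum>k\<in>set_mset M. (if k = 1 then 1 else real (k - 1) * real (count M (k - 1) + 1)) * g k)"
    unfolding sum.distrib[symmetric]
  proof (rule sum.cong[OF refl])
    fix k
    show "(if k = 1 then g k else 0) + real (card {b \<in> S. k = card (orbit p b) + 1}) * g k =
        (if k = 1 then 1 else real (k - 1) * real (count M (k - 1) + 1)) * g k"
    \<comment> \<open>Orbits are nonempty, so no \<open>b\<close> in \<open>S\<close> qualifies
      here. For \<open>k = 0\<close> truncated subtraction makes the coefficient 0 as well.\<close>
    proof (cases "k = 0 \<or> k = 1")
      case True
      have "k \<noteq> card (orbit p b) + 1" for b
        using card_orbit_pos[OF S p, of b] True by auto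
      then have empty: "{b \<in> S. k = card (orbit p b) + 1} = {}" by simp
      show ?thesis unfolding empty using True by auto
    next
      case False
      then have "{b \<in> S. k = card (orbit p b) + 1} = {b \<in> S. card (orbit p b) = k - 1}" by auto
      then have *: "card {b \<in> S. k = card (orbit p b) + 1} = (k - 1) * count (cycle_type S p) (k - 1)"
        by (simp add: card_elements_orbit_size[OF S p])
      show ?thesis
      proof (cases "cycle_type S p = M' k")
        case True
        then have count: "count (cycle_type S p) (k - 1) = count M (k - 1) + 1"
          using False by (auto simp: M'_def)
        show ?thesis unfolding * count of_nat_mult using False by simp
      qed (auto simp: g_def)
    qed
  qed
  finally show ?thesis unfolding g_def .
qed

lemma sum_mset_multiplicity: "\<Sum>\<^sub># M = (\<Sum>k\<in>set_mset M. count M k * k)" for M :: "nat multiset"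
proof -
  \<comment> \<open>A fixed index set \<open>A\<close> is not affected when the induction adds an
    element to \<open>M\<close>.\<close>
  have "\<Sum>\<^sub># M = (\<Sum>k\<in>A. count M k * k)" if "finite A" "set_mset M \<subseteq> A" for A
    using that(2)
  proof (induction M)
    case (add x M)
    have "count (add_mset x M) k * k = (if k = x then x else 0) + count M k * k" for k
      by simp
    then show ?case using add that(1) by (simp add: sum.distrib)
  qed simp
  then show ?thesis by simp
qed

text \<open>The size of a conjugacy class, multiplied out to avoid division. The induction
  classifies permutations by the length \<open>k\<close> of the cycle through the new point.\<close>

lemma sum_permutations_of_cycle_type:
  "finite S \<Longrightarrow> 0 \<notin># M \<Longrightarrow> \<Sum>\<^sub># M = card S \<Longrightarrow>
    (\<Sum>p | p permutes S. of_bool (cycle_type S p = M)) * centralizer_size M = fact (card S)"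
proof (induction S arbitrary: M rule: finite_induct)
  case empty
  then have "M = {#}" by (metis card.empty multiset_nonemptyE sum_mset_0_iff)
  then show ?case by (simp add: centralizer_size_def card_mset_def)
next
  case (insert a S)
  define M' where "M' = (\<lambda>k. if k = 1 then M - {#1#} else add_mset (k - 1) (M - {#k#}))"
  define c where "c = (\<lambda>k. if k = 1 then 1 else real (k - 1) * real (count M (k - 1) + 1))"
  \<comment> \<open>The ratio of the centralizer orders turns the coefficient \<open>c k\<close>
    into \<open>k * count M k\<close>. These numbers add up to the sum of the parts,
    \<open>card S + 1\<close>, which is the factor needed for the next factorial.\<close>
  have cs: "c k * centralizer_size M = real (k * count M k) * centralizer_size (M' k)"
    if k: "k \<in># M" for k
  proof -
    obtain M0 where M: "M = add_mset k M0" using k by (metis insert_DiffM)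
    have "k \<noteq> 0" using k insert.prems by metis
    then have "c k * centralizer_size M0 = centralizer_size (M' k)"
      by (auto simp: c_def M'_def M centralizer_size_add_mset)
    from this[symmetric] show ?thesis
      by (simp add: M centralizer_size_add_mset algebra_simps)
  qed
  have N: "(\<Sum>p | p permutes S. of_bool (cycle_type S p = M' k)) * centralizer_size (M' k) = fact (card S)"
    if k: "k \<in># M" for k
  proof (rule insert.IH)
    obtain M0 where M: "M = add_mset k M0" using k by (metis insert_DiffM)
    have "k \<noteq> 0" using k insert.prems by metis
    moreover have "0 \<notin># M0" "k + \<Sum>\<^sub># M0 = Suc (card S)"
      using insert.prems insert.hyps by (auto simp: M)
    ultimately show "0 \<notin># M' k" "\<Sum>\<^sub># (M' k) = card S"
      by (auto simp: M'_def M)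
  qed
  have "(\<Sum>p | p permutes insert a S. of_bool (cycle_type (insert a S) p = M)) =
      (\<Sum>q | q permutes S. \<Sum>b\<in>insert a S.
        of_bool (cycle_type (insert a S) (transpose a b \<circ> q) = M) :: real)"
    unfolding sum_over_permutations_insert[OF insert.hyps] by (rule sum.swap)
  also have "\<dots> = (\<Sum>q | q permutes S. \<Sum>k\<in>set_mset M. c k * of_bool (cycle_type S q = M' k))"
    unfolding c_def M'_def
    using insert.hyps by (intro sum.cong[OF refl] sum_of_bool_cycle_type_insert) auto
  also have "\<dots> = (\<Sum>k\<in>set_mset M. c k * (\<Sum>q | q permutes S. of_bool (cycle_type S q = M' k)))"
    unfolding sum_distrib_left by (rule sum.swap)
  finally have "(\<Sum>p | p permutes insert a S. of_bool (cycle_type (insert a S) p = M)) * centralizer_size M =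
      (\<Sum>k\<in>set_mset M. (\<Sum>q | q permutes S. of_bool (cycle_type S q = M' k)) * (c k * centralizer_size M))"
    by (simp only: sum_distrib_right[where r = "centralizer_size M"]) (simp only: mult_ac)
  also have "\<dots> = (\<Sum>k\<in>set_mset M. real (k * count M k) * fact (card S))"
    using N by (intro sum.cong) (simp_all add: cs mult.left_commute)
  also have "\<dots> = real (\<Sum>k\<in>set_mset M. k * count M k) * fact (card S)"
    by (simp add: sum_distrib_right)
  also have "(\<Sum>k\<in>set_mset M. k * count M k) = \<Sum>\<^sub># M"
    by (simp add: sum_mset_multiplicity mult.commute)
  finally show ?case
    using insert.hyps insert.prems by simp
qed

section \<open>From the probability to sums over pairs of full cycles\<close>

definition mset_of_parts :: "(nat \<Rightarrow> nat) \<Rightarrow> nat multiset" where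
  "mset_of_parts \<nu> = (\<Sum>l\<in>parts \<nu>. replicate_mset (\<nu> l) l)"

lemma count_mset_of_parts:
  "finite (parts \<nu>) \<Longrightarrow> count (mset_of_parts \<nu>) l = (if l \<ge> 1 then \<nu> l else 0)"
  by (auto simp: mset_of_parts_def count_sum parts_def)

lemma set_mset_of_parts: "finite (parts \<nu>) \<Longrightarrow> set_mset (mset_of_parts \<nu>) = parts \<nu>"
  by (auto simp: set_mset_def count_mset_of_parts parts_def split: if_splits)

lemma cycle_type_prob_eq:
  assumes "N \<ge> 1" and fin: "finite (parts \<nu>)"
  shows "cycle_type_prob N \<nu> = (\<Sum>p1\<in>cycles_on {1..N}. \<Sum>p2\<in>cycles_on {1..N}.
    of_bool (cycle_type {1..N} (p1 \<circ> p2) = mset_of_parts \<nu>)) / (fact (N - 1))\<^sup>2"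
proof -
  define K where "K = cycles_on {1..N}"
  have K: "full_cycles N = K" by (simp add: full_cycles_def cycles_on_def K_def)
  have finK: "finite K" by (simp add: K_def finite_cycles_on)
  have cardK: "card K = fact (N - 1)" using assms(1) by (simp add: K_def card_cycles_on)
  then have "K \<noteq> {}" by (metis card.empty fact_nonzero)
  define E :: "((nat \<Rightarrow> nat) \<times> (nat \<Rightarrow> nat)) set"
    where "E = {(p1, p2). \<forall>l\<ge>1. num_cycles N (p1 \<circ> p2) l = \<nu> l}"
  have E: "(p1, p2) \<in> E \<longleftrightarrow> cycle_type {1..N} (p1 \<circ> p2) = mset_of_parts \<nu>"
    if "p1 \<in> K" "p2 \<in> K" for p1 p2
  proof -
    have p: "p1 \<circ> p2 permutes {1..N}"
      using that by (auto simp: K_def cycles_on_def intro: permutes_compose)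
    have count: "count (cycle_type {1..N} (p1 \<circ> p2)) l = num_cycles N (p1 \<circ> p2) l" for l
      by (simp add: count_card_mset num_cycles_def)
    \<comment> \<open>Multiset equality also compares multiplicities at 0; there both sides are 0,
      so the event with \<open>l \<ge> 1\<close> is matched exactly.\<close>
    have "num_cycles N (p1 \<circ> p2) 0 = 0"
      using card_orbit_pos[OF _ p] by (auto simp: num_cycles_def)
    then show ?thesis
      unfolding E_def multiset_eq_iff count count_mset_of_parts[OF fin]
      by (auto simp: Suc_le_eq)
  qed
  have "pair_pmf (pmf_of_set K) (pmf_of_set K) = pmf_of_set (K \<times> K)"
  proof (rule pmf_eqI)
    fix x :: "(nat \<Rightarrow> nat) \<times> (nat \<Rightarrow> nat)"
    show "pmf (pair_pmf (pmf_of_set K) (pmf_of_set K)) x = pmf (pmf_of_set (K \<times> K)) x"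
      using finK \<open>K \<noteq> {}\<close>
      by (cases x) (simp add: pmf_pair indicator_times card_cartesian_product)
  qed
  then have "cycle_type_prob N \<nu> = card (K \<times> K \<inter> E) / card (K \<times> K)"
    unfolding cycle_type_prob_def random_full_cycle_pair_def K E_def[symmetric]
    using finK \<open>K \<noteq> {}\<close> by (simp add: measure_pmf_of_set)
  also have "real (card (K \<times> K \<inter> E)) = (\<Sum>x\<in>K \<times> K. of_bool (x \<in> E))"
    using finK by (simp add: of_bool_def sum.If_cases)
  also have "\<dots> = (\<Sum>p1\<in>K. \<Sum>p2\<in>K. of_bool ((p1, p2) \<in> E))"
    by (simp add: sum.cartesian_product)
  also have "\<dots> = (\<Sum>p1\<in>K. \<Sum>p2\<in>K. of_bool (cycle_type {1..N} (p1 \<circ> p2) = mset_of_parts \<nu>))"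
    by (intro sum.cong refl) (simp add: E)
  finally show ?thesis
    unfolding K_def[symmetric]
    by (simp only: card_cartesian_product cardK of_nat_mult of_nat_fact power2_eq_square)
qed

theorem theorem3p7:
  fixes N :: nat and \<nu> :: "nat \<Rightarrow> nat"
  assumes "N \<ge> 1"
    and "finite (parts \<nu>)"
    and "(\<Sum>l\<in>parts \<nu>. l * \<nu> l) = N"
  shows "cycle_type_prob N \<nu> =
    real N / (\<Prod>l\<in>parts \<nu>. real l ^ \<nu> l * fact (\<nu> l)) *
      integral {0..1}
        (\<lambda>t::real. \<Prod>l\<in>parts \<nu>. (t ^ l + (-1) ^ (l + 1) * (1 - t) ^ l) ^ \<nu> l)"
proof -
  define M where "M = mset_of_parts \<nu>"
  have set: "set_mset M = parts \<nu>" unfolding M_def by (rule set_mset_of_parts[OF assms(2)])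
  have count: "count M l = \<nu> l" if "l \<in> parts \<nu>" for l
    using that count_mset_of_parts[OF assms(2)] by (simp add: M_def parts_def)
  have cs: "centralizer_size M = (\<Prod>l\<in>parts \<nu>. real l ^ \<nu> l * fact (\<nu> l))"
    by (simp add: centralizer_size_def set count)
  then have cs0: "centralizer_size M \<noteq> 0"
    using assms(2) by (auto simp: parts_def)
  have "cycle_poly l t = t ^ l + (-1) ^ (l + 1) * (1 - t) ^ l" for l and t :: real
  proof -
    have "(t - 1) ^ l = (-1) ^ l * (1 - t) ^ l"
      by (simp flip: power_mult_distrib)
    then show ?thesis by (simp add: cycle_poly_def)
  qed
  then have weight: "cycle_weight M =
      integral {0..1} (\<lambda>t. \<Prod>l\<in>parts \<nu>. (t ^ l + (-1) ^ (l + 1) * (1 - t) ^ l) ^ \<nu> l)"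
    unfolding cycle_weight_def image_prod_mset_multiplicity set by (simp add: count)
  have "(\<Sum>p1\<in>cycles_on {1..N}. \<Sum>p2\<in>cycles_on {1..N}. of_bool (cycle_type {1..N} (p1 \<circ> p2) = M)) =
      fact (N - 1) * (\<Sum>p | p permutes {1..N}.
        of_bool (cycle_type {1..N} p = M) * cycle_weight (cycle_type {1..N} p))"
    using assms(1) sum_cycles_on_pairs[of "{1..N}" "\<lambda>p. of_bool (cycle_type {1..N} p = M)"] by simp
  \<comment> \<open>The weight depends only on the cycle type, so it is the constant
    \<open>cycle_weight M\<close> wherever the indicator is 1.\<close>
  also have "(\<Sum>p | p permutes {1..N}.
        of_bool (cycle_type {1..N} p = M) * cycle_weight (cycle_type {1..N} p)) =
      (\<Sum>p | p permutes {1..N}. of_bool (cycle_type {1..N} p = M)) * cycle_weight M"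
    unfolding sum_distrib_right by (intro sum.cong) auto
  also have "(\<Sum>p | p permutes {1..N}. of_bool (cycle_type {1..N} p = M)) = fact N / centralizer_size M"
  proof -
    have "0 \<notin># M" unfolding set by (simp add: parts_def)
    moreover have "\<Sum>\<^sub># M = N"
      using assms(3) by (simp add: sum_mset_multiplicity set count mult.commute)
    ultimately show ?thesis
      using sum_permutations_of_cycle_type[of "{1..N}" M] cs0 by (simp add: eq_divide_eq)
  qed
  finally have "cycle_type_prob N \<nu> =
      fact (N - 1) * (fact N / centralizer_size M * cycle_weight M) / (fact (N - 1))\<^sup>2"
    unfolding cycle_type_prob_eq[OF assms(1,2)] M_def[symmetric] by (simp only:)
  also have "\<dots> = real N / centralizer_size M * cycle_weight M"
    using assms(1) by (simp add: fact_reduce[of N] power2_eq_square)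
  finally show ?thesis unfolding cs weight .
qed

end
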